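(* A function $f :\subseteq \{0,1\}^\mathbb{N} \to \{0,1\}^\mathbb{N}$ is Markov-effectively $\Delta_2^0$-measurable if and only if it is low computable.
   Context: Let $(U_n)_{n \in \mathbb{N}}$ be a fixed effective (total) enumeration of the computably open subsets of $\{0,1\}^\mathbb{N}$, and let $(D_n)_{n\in\mathbb{N}}$ be a fixed effective partial enumeration of the computably $\Delta_2^0$ subsets of (the domain of $f$ in) $\{0,1\}^\mathbb{N}$, where a set is computably $\Delta_2^0$ if it is $\bigcup_i A_i = \bigcap_i U'_i$ for a computable sequence of closed sets $A_i$ (given by complements as open sets) and open sets $U'_i$. $f$ is Markov-effectively $\Delta_2^0$-measurable iff there is a partial computable $P :\subseteq \mathbb{N} \to \mathbb{N}$ such that for every $n$, $D_{P(n)}$ is the $\Delta_2^0$ set $f^{-1}(U_n)$. The Turing jump $J : \{0,1\}^\mathbb{N} \to \{0,1\}^\mathbb{N}$ is defined by $J(p)(i) = 1$ iff $p \in U_i$. $f$ is low computable iff there is a computable procedure that, from any $p \in \operatorname{dom}(f)$, computes a sequence $(q_k)_{k}$ in $\{0,1\}^\mathbb{N}$ converging to $J(f(p))$. *)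

theory Defs
  imports "HOL-Analysis.Function_Topology" "HOL-Library.Nat_Bijection"
begin

type_synonym cantor = "nat \<Rightarrow> bool"

section \<open>Computability relative to an oracle\<close>

text \<open>
  Partial recursive functions relative to an oracle, in their unary presentation: several
  arguments are packed with the Cantor pairing function \<^const>\<open>prod_encode\<close>. Evaluation is strict.
  An oracle machine with oracle \<open>p\<close> plays the role of a type-2 machine with input \<open>p\<close>.
\<close>

datatype prog =
    RZero | RSucc | RFst | RSnd | ROracle
  | RPair prog prog | RComp prog prog | RRec prog prog | RMu prog

text \<open>
  \<open>RRec f g\<close> is primitive recursion on the second component of the argument, and \<open>RMu f\<close> is
  unbounded minimisation, defined only if all values before the first zero are defined.
\<close>

primrec eval :: "prog \<Rightarrow> cantor \<Rightarrow> nat \<Rightarrow> nat option" where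
  "eval RZero p n = Some 0"
| "eval RSucc p n = Some (Suc n)"
| "eval RFst p n = Some (fst (prod_decode n))"
| "eval RSnd p n = Some (snd (prod_decode n))"
| "eval ROracle p n = Some (of_bool (p n))"
| "eval (RPair f g) p n =
     Option.bind (eval f p n) (\<lambda>a. Option.bind (eval g p n) (\<lambda>b. Some (prod_encode (a, b))))"
| "eval (RComp f g) p n = Option.bind (eval g p n) (eval f p)"
| "eval (RRec f g) p n =
     rec_nat (eval f p (fst (prod_decode n)))
       (\<lambda>i r. Option.bind r
         (\<lambda>v. eval g p (prod_encode (fst (prod_decode n), prod_encode (i, v)))))
       (snd (prod_decode n))"
| "eval (RMu f) p n =
     (if \<exists>m. eval f p (prod_encode (n, m)) = Some 0 \<and>
             (\<forall>i<m. eval f p (prod_encode (n, i)) \<noteq> None)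
      then Some (LEAST m. eval f p (prod_encode (n, m)) = Some 0) else None)"

text \<open>The Goedel numbering of programs; it is a bijection, see \<open>bij_encode\<close> below.\<close>

primrec encode :: "prog \<Rightarrow> nat" where
  "encode RZero = 0"
| "encode RSucc = 1"
| "encode RFst = 2"
| "encode RSnd = 3"
| "encode ROracle = 4"
| "encode (RPair f g) = 5 + 4 * prod_encode (encode f, encode g)"
| "encode (RComp f g) = 6 + 4 * prod_encode (encode f, encode g)"
| "encode (RRec f g) = 7 + 4 * prod_encode (encode f, encode g)"
| "encode (RMu f) = 8 + 4 * encode f"

text \<open>Computability without an oracle is computability relative to the constant oracle.\<close>

definition partial_computable :: "(nat \<Rightarrow> nat option) \<Rightarrow> bool" where
  "partial_computable g \<longleftrightarrow> (\<exists>c. \<forall>n. eval c (\<lambda>_. False) n = g n)"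


section \<open>Computably open and computably \<open>\<Delta>\<^sup>0\<^sub>2\<close> sets\<close>

text \<open>
  A set is computably open iff membership is semidecidable, i.e. its characteristic function into
  the Sierpinski space is computable. A sequence of open sets is computable iff this holds
  uniformly in the index: the \<open>i\<close>-th set consists of the oracles with which a fixed program halts
  on input \<open>i\<close>. By lemma \<open>open_ce_open\<close> below these sets are open in the product topology.
\<close>

definition ce_open :: "prog \<Rightarrow> nat \<Rightarrow> cantor set" where
  "ce_open c i = {p. eval c p i \<noteq> None}"

definition computably_open :: "cantor set \<Rightarrow> bool" where
  "computably_open S \<longleftrightarrow> (\<exists>c. S = ce_open c 0)"

definition computable_open_seq :: "(nat \<Rightarrow> cantor set) \<Rightarrow> bool" where
  "computable_open_seq V \<longleftrightarrow> (\<exists>c. \<forall>i. V i = ce_open c i)"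

definition computable_closed_seq :: "(nat \<Rightarrow> cantor set) \<Rightarrow> bool" where
  "computable_closed_seq A \<longleftrightarrow> computable_open_seq (\<lambda>i. - A i)"

definition computably_delta2 :: "cantor set \<Rightarrow> cantor set \<Rightarrow> bool" where
  "computably_delta2 X S \<longleftrightarrow>
     (\<exists>A V. computable_closed_seq A \<and> computable_open_seq V \<and>
            S = X \<inter> (\<Union>i. A i) \<and> S = X \<inter> (\<Inter>i. V i))"

text \<open>
  The pair of programs \<open>a, b\<close> is a name of the \<open>\<Delta>\<^sup>0\<^sub>2\<close> subset \<open>S\<close> of \<open>X\<close>; not every pair of
  programs is a name.
\<close>

definition delta2_name :: "cantor set \<Rightarrow> prog \<Rightarrow> prog \<Rightarrow> cantor set \<Rightarrow> bool" where
  "delta2_name X a b S \<longleftrightarrow>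
     S = X \<inter> (\<Union>i. - ce_open a i) \<and> S = X \<inter> (\<Inter>i. ce_open b i)"


section \<open>Effective enumerations\<close>

text \<open>
  For the open sets it is only required that the enumeration is onto the computably open sets and
  that a program for \<open>U n\<close> can be computed from \<open>n\<close>. This includes all acceptable numberings.
\<close>

definition effective_open_enumeration :: "(nat \<Rightarrow> cantor set) \<Rightarrow> bool" where
  "effective_open_enumeration U \<longleftrightarrow>
     range U = {S. computably_open S} \<and>
     (\<exists>r. partial_computable r \<and> (\<forall>n. \<exists>c. r n = Some (encode c) \<and> U n = ce_open c 0))"

text \<open>
  For the \<open>\<Delta>\<^sup>0\<^sub>2\<close> sets, a name can be computed from an index and an index from a name, i.e. \<open>D\<close>
  is equivalent to the numbering of the \<open>\<Delta>\<^sup>0\<^sub>2\<close> sets by Goedel numbers of their names.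
\<close>

definition effective_delta2_enumeration ::
    "cantor set \<Rightarrow> (nat \<Rightarrow> cantor set option) \<Rightarrow> bool" where
  "effective_delta2_enumeration X D \<longleftrightarrow>
     ran D = {S. computably_delta2 X S} \<and>
     (\<exists>r. partial_computable r \<and>
       (\<forall>n S. D n = Some S \<longrightarrow>
         (\<exists>a b. r n = Some (prod_encode (encode a, encode b)) \<and> delta2_name X a b S))) \<and>
     (\<exists>s. partial_computable s \<and>
       (\<forall>a b S. delta2_name X a b S \<longrightarrow>
         (\<exists>n. s (prod_encode (encode a, encode b)) = Some n \<and> D n = Some S)))"


section \<open>Measurability and low computability\<close>

definition markov_delta2_measurable ::
    "(nat \<Rightarrow> cantor set) \<Rightarrow> (nat \<Rightarrow> cantor set option) \<Rightarrow> (cantor \<Rightarrow> cantor option) \<Rightarrow> bool" where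
  "markov_delta2_measurable U D f \<longleftrightarrow>
     (\<exists>P. partial_computable P \<and>
       (\<forall>n. \<exists>m. P n = Some m \<and> D m = Some {p. \<exists>q. f p = Some q \<and> q \<in> U n}))"

definition turing_jump :: "(nat \<Rightarrow> cantor set) \<Rightarrow> cantor \<Rightarrow> cantor" where
  "turing_jump U p = (\<lambda>i. p \<in> U i)"

text \<open>
  The sequence \<open>q\<close> is computed from \<open>p\<close> by a program that, with oracle \<open>p\<close>, maps (the code of)
  \<open>(k, i)\<close> to the bit \<open>q k i\<close>. Convergence is in the product topology.
\<close>

definition low_computable ::
    "(nat \<Rightarrow> cantor set) \<Rightarrow> (cantor \<Rightarrow> cantor option) \<Rightarrow> bool" where
  "low_computable U f \<longleftrightarrow>
     (\<exists>c. \<forall>p y. f p = Some y \<longrightarrow>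
       (\<exists>q :: nat \<Rightarrow> cantor.
         (\<forall>k i. eval c p (prod_encode (k, i)) = Some (of_bool (q k i))) \<and>
         q \<longlonglongrightarrow> turing_jump U y))"


section \<open>Consistency of the definitions\<close>

lemma inj_encode: "inj encode"
proof (rule injI)
  fix c d show "encode c = encode d \<Longrightarrow> c = d"
  proof (induction c arbitrary: d)
    case (RPair c1 c2) then show ?case by (cases d; simp; presburger)
  next
    case (RComp c1 c2) then show ?case by (cases d; simp; presburger)
  next
    case (RRec c1 c2) then show ?case by (cases d; simp; presburger)
  next
    case (RMu c) then show ?case by (cases d; simp; presburger)
  qed (case_tac d; simp; fail)+
qed

lemma bij_encode: "bij encode"
proof -
  have "\<exists>c. encode c = n" for n
  proof (induction n rule: less_induct)
    case (less n)
    show ?case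
    proof (cases "n < 5")
      case True
      then have "n = 0 \<or> n = 1 \<or> n = 2 \<or> n = 3 \<or> n = 4" by auto
      then show ?thesis
        by (elim disjE) (auto intro: exI[of _ RZero] exI[of _ RSucc] exI[of _ RFst]
          exI[of _ RSnd] exI[of _ ROracle])
    next
      case False
      define k where "k = (n - 5) div 4"
      define a b where "a = fst (prod_decode k)" and "b = snd (prod_decode k)"
      have k: "k = prod_encode (a, b)" by (simp add: a_def b_def)
      have "k < n" using False by (auto simp: k_def)
      moreover have "a \<le> k" "b \<le> k" unfolding k by (rule le_prod_encode_1 le_prod_encode_2)+
      ultimately obtain ca cb ck where c: "encode ca = a" "encode cb = b" "encode ck = k"
        using less.IH by (meson le_less_trans)
      have "n = 5 + 4 * k \<or> n = 6 + 4 * k \<or> n = 7 + 4 * k \<or> n = 8 + 4 * k"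
        using False unfolding k_def by presburger
      moreover have "encode (RPair ca cb) = 5 + 4 * k" "encode (RComp ca cb) = 6 + 4 * k"
        "encode (RRec ca cb) = 7 + 4 * k" "encode (RMu ck) = 8 + 4 * k"
        by (simp_all add: c k)
      ultimately show ?thesis by metis
    qed
  qed
  then show ?thesis using inj_encode by (metis bijI surjI surj_def)
qed

lemma eval_continuous:
  "eval c p n = Some v \<Longrightarrow> eventually (\<lambda>q. eval c q n = Some v) (nhds p)"
proof (induction c arbitrary: n v)
  case ROracle
  have "open ((\<lambda>q :: cantor. q n) -` {p n})"
    by (rule open_vimage) (auto intro: open_discrete continuous_on_product_coordinates)
  then have "eventually (\<lambda>q. q \<in> (\<lambda>q. q n) -` {p n}) (nhds p)"
    by (rule eventually_nhds_in_open) simp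
  then show ?case using ROracle by (auto elim: eventually_mono)
next
  case (RPair c1 c2)
  then obtain a b where "eval c1 p n = Some a" "eval c2 p n = Some b" "v = prod_encode (a, b)"
    by (auto simp: bind_eq_Some_conv)
  from eventually_elim2[OF RPair.IH(1)[OF this(1)] RPair.IH(2)[OF this(2)]] this(3)
  show ?case by simp
next
  case (RComp c1 c2)
  then obtain a where "eval c2 p n = Some a" "eval c1 p a = Some v"
    by (auto simp: bind_eq_Some_conv)
  from eventually_elim2[OF RComp.IH(2)[OF this(1)] RComp.IH(1)[OF this(2)]]
  show ?case by simp
next
  case (RRec c1 c2)
  define a where "a = fst (prod_decode n)"
  define R where "R q k = rec_nat (eval c1 q a)
     (\<lambda>i r. Option.bind r (\<lambda>v. eval c2 q (prod_encode (a, prod_encode (i, v))))) k" for q k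
  have "eventually (\<lambda>q. R q k = Some v) (nhds p)" if "R p k = Some v" for k v
    using that
  proof (induction k arbitrary: v)
    case 0 then show ?case using RRec.IH by (simp add: R_def)
  next
    case (Suc k)
    then obtain w where "R p k = Some w" "eval c2 p (prod_encode (a, prod_encode (k, w))) = Some v"
      by (auto simp: R_def bind_eq_Some_conv)
    with Suc.IH RRec.IH(2) have "eventually (\<lambda>q. R q k = Some w) (nhds p)"
      "eventually (\<lambda>q. eval c2 q (prod_encode (a, prod_encode (k, w))) = Some v) (nhds p)" by auto
    from eventually_elim2[OF this] show ?case by (simp add: R_def)
  qed
  then show ?case using RRec.prems by (simp add: R_def a_def)
next
  case (RMu c)
  let ?E = "\<lambda>q m. eval c q (prod_encode (n, m))"
  have ex: "\<exists>m. ?E p m = Some 0 \<and> (\<forall>i<m. ?E p i \<noteq> None)"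
    and v: "v = (LEAST m. ?E p m = Some 0)"
    using RMu.prems by (auto split: if_splits)
  have v0: "?E p v = Some 0" unfolding v using ex by (auto intro: LeastI)
  have below: "?E p i \<noteq> None \<and> ?E p i \<noteq> Some 0" if "i < v" for i
    using ex that unfolding v
    by (metis (mono_tags, lifting) Least_le not_less_Least order_less_le_trans)
  have "eventually (\<lambda>q. \<forall>i\<in>{..v}. ?E q i = ?E p i) (nhds p)"
  proof (rule eventually_ball_finite)
    show "\<forall>i\<in>{..v}. eventually (\<lambda>q. ?E q i = ?E p i) (nhds p)"
    proof
      fix i assume "i \<in> {..v}"
      then have "?E p i \<noteq> None" using below v0 by (cases "i = v") auto
      then obtain w where "?E p i = Some w" by auto
      with RMu.IH show "eventually (\<lambda>q. ?E q i = ?E p i) (nhds p)" by simp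
    qed
  qed simp
  then show ?case
  proof (rule eventually_mono)
    fix q assume *: "\<forall>i\<in>{..v}. ?E q i = ?E p i"
    then have q0: "?E q v = Some 0" and qb: "\<And>i. i < v \<Longrightarrow> ?E q i \<noteq> None \<and> ?E q i \<noteq> Some 0"
      using v0 below by auto
    have "(LEAST m. ?E q m = Some 0) = v"
      using q0 qb by (intro Least_equality) (auto simp: not_less[symmetric])
    then show "eval (RMu c) q n = Some v" using q0 qb by auto
  qed
qed auto

lemma open_ce_open: "open (ce_open c i)"
proof (subst open_subopen, intro ballI)
  fix p assume "p \<in> ce_open c i"
  then obtain v where "eval c p i = Some v" by (auto simp: ce_open_def)
  from eval_continuous[OF this] obtain T where
    "open T" "p \<in> T" "\<forall>q\<in>T. eval c q i = Some v"
    by (auto simp: eventually_nhds)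
  then show "\<exists>T. open T \<and> p \<in> T \<and> T \<subseteq> ce_open c i" by (auto simp: ce_open_def)
qed

lemma computably_delta2_iff_name: "computably_delta2 X S \<longleftrightarrow> (\<exists>a b. delta2_name X a b S)"
proof
  assume "computably_delta2 X S"
  then obtain A V a b where "\<forall>i. - A i = ce_open a i" "\<forall>i. V i = ce_open b i"
    "S = X \<inter> (\<Union>i. A i)" "S = X \<inter> (\<Inter>i. V i)"
    unfolding computably_delta2_def computable_closed_seq_def computable_open_seq_def by metis
  moreover from this(1) have "A i = - ce_open a i" for i by (metis double_complement)
  ultimately show "\<exists>a b. delta2_name X a b S" 
    unfolding delta2_name_def by (intro exI[of _ a] exI[of _ b]) simp
next
  assume "\<exists>a b. delta2_name X a b S"
  then obtain a b where "delta2_name X a b S" by blast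
  then show "computably_delta2 X S"
    unfolding computably_delta2_def computable_closed_seq_def computable_open_seq_def delta2_name_def
    by (intro exI[of _ "\<lambda>i. - ce_open a i"] exI[of _ "ce_open b"]) auto
qed

lemma partial_computable_Some: "partial_computable Some"
  unfolding partial_computable_def by (rule exI[of _ "RPair RFst RSnd"]) simp

lemma effective_open_enumeration_standard:
  "effective_open_enumeration (\<lambda>n. ce_open (inv encode n) 0)"
  unfolding effective_open_enumeration_def
proof
  show "range (\<lambda>n. ce_open (inv encode n) 0) = {S. computably_open S}"
    using inv_f_f[OF inj_encode] by (auto simp: computably_open_def) (metis rangeI)
  show "\<exists>r. partial_computable r \<and>
    (\<forall>n. \<exists>c. r n = Some (encode c) \<and> ce_open (inv encode n) 0 = ce_open c 0)"
    by (rule exI[of _ Some])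
      (auto simp: partial_computable_Some surj_f_inv_f[OF bij_is_surj[OF bij_encode]]
        intro!: exI[of _ "inv encode _"])
qed

lemma effective_delta2_enumeration_standard:
  "\<exists>D. effective_delta2_enumeration X D"
proof -
  define Q where "Q n S \<longleftrightarrow>
    (\<exists>a b. n = prod_encode (encode a, encode b) \<and> delta2_name X a b S)" for n S
  define D where "D n = (if \<exists>S. Q n S then Some (SOME S. Q n S) else None)" for n
  have uniq: "S = T" if "Q n S" "Q n T" for n S T
    using that inj_encode unfolding Q_def delta2_name_def by (auto simp: inj_eq)
  have D: "D n = Some S \<longleftrightarrow> Q n S" for n S
    unfolding D_def using uniq by (auto intro: someI)
  have "effective_delta2_enumeration X D"
    unfolding effective_delta2_enumeration_def
  proof (intro conjI)
    show "ran D = {S. computably_delta2 X S}"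
      unfolding ran_def D computably_delta2_iff_name Q_def by auto
    show "\<exists>r. partial_computable r \<and> (\<forall>n S. D n = Some S \<longrightarrow>
        (\<exists>a b. r n = Some (prod_encode (encode a, encode b)) \<and> delta2_name X a b S))"
      unfolding D Q_def using partial_computable_Some by blast
    show "\<exists>s. partial_computable s \<and> (\<forall>a b S. delta2_name X a b S \<longrightarrow>
        (\<exists>n. s (prod_encode (encode a, encode b)) = Some n \<and> D n = Some S))"
      unfolding D Q_def using partial_computable_Some by blast
  qed
  then show ?thesis by blast
qed

end

theory Submission
  imports Defs
begin

text \<open>
  Both directions express \<open>\<Delta>\<^sup>0\<^sub>2\<close> sets as limits. If \<open>q\<^sub>k\<close> converges to the jump of \<open>f p\<close>, then \<open>p\<close> lies
  in the preimage of \<open>U n\<close> iff \<open>q\<^sub>k n\<close> holds for infinitely many \<open>k\<close>, iff it holds for almost all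
  \<open>k\<close>, and the s-m-n construction turns these two conditions into a name.
  Conversely, a name \<open>a, b\<close> of the preimage of \<open>U n\<close> supplies a list of candidates, each claiming
  that some run of \<open>a\<close> (a witness for membership) or of \<open>b\<close> (a witness against it) diverges.
  A step-bounded universal machine moves to the next candidate whenever the current one is
  refuted, so it settles on a correct one, and its type is the limit.
\<close>

section \<open>Total functions computable in the oracle\<close>

abbreviation pfst :: "nat \<Rightarrow> nat" where "pfst n \<equiv> fst (prod_decode n)"
abbreviation psnd :: "nat \<Rightarrow> nat" where "psnd n \<equiv> snd (prod_decode n)"

text \<open>Totality is demanded because evaluation is strict: a case distinction may then evaluate
  a branch that it discards. One program serves all oracles.\<close>

definition oracle_computable :: "(cantor \<Rightarrow> nat \<Rightarrow> nat) \<Rightarrow> bool" where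
  "oracle_computable F \<longleftrightarrow> (\<exists>c. \<forall>p n. eval c p n = Some (F p n))"

named_theorems oc_intros

lemma oc_comp:
  assumes "oracle_computable F" "oracle_computable A"
  shows "oracle_computable (\<lambda>p n. F p (A p n))"
proof -
  obtain f a where "\<And>p n. eval f p n = Some (F p n)" "\<And>p n. eval a p n = Some (A p n)"
    using assms unfolding oracle_computable_def by metis
  then show ?thesis
    unfolding oracle_computable_def by (intro exI[of _ "RComp f a"]) simp
qed

lemma oc_Suc_raw: "oracle_computable (\<lambda>p n. Suc n)"
  unfolding oracle_computable_def by (rule exI[of _ RSucc]) simp

lemma oc_pfst_raw: "oracle_computable (\<lambda>p n. pfst n)"
  unfolding oracle_computable_def by (rule exI[of _ RFst]) simp

lemma oc_psnd_raw: "oracle_computable (\<lambda>p n. psnd n)"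
  unfolding oracle_computable_def by (rule exI[of _ RSnd]) simp

lemma oc_oracle_raw: "oracle_computable (\<lambda>p n. of_bool (p n))"
  unfolding oracle_computable_def by (rule exI[of _ ROracle]) simp

text \<open>The arbitrary argument \<open>A p n\<close> lets \<open>intro oc_intros\<close>
  decompose nested terms.\<close>

lemmas oc_Suc [oc_intros] = oc_comp[OF oc_Suc_raw]
lemmas oc_pfst [oc_intros] = oc_comp[OF oc_pfst_raw]
lemmas oc_psnd [oc_intros] = oc_comp[OF oc_psnd_raw]
lemmas oc_oracle [oc_intros] = oc_comp[OF oc_oracle_raw]

text \<open>No constructor is the identity; splitting the argument and pairing it again is, because
  the pairing is a bijection.\<close>

lemma oc_id [oc_intros]: "oracle_computable (\<lambda>p n. n)"
  unfolding oracle_computable_def by (rule exI[of _ "RPair RFst RSnd"]) simp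

lemma oc_const [oc_intros]: "oracle_computable (\<lambda>p n. k)"
proof (induction k)
  case 0
  show ?case unfolding oracle_computable_def by (rule exI[of _ RZero]) simp
next
  case (Suc k)
  from oc_Suc[OF this] show ?case .
qed

lemma oc_pair [oc_intros]:
  assumes "oracle_computable A" "oracle_computable B"
  shows "oracle_computable (\<lambda>p n. prod_encode (A p n, B p n))"
proof -
  obtain a b where "\<And>p n. eval a p n = Some (A p n)" "\<And>p n. eval b p n = Some (B p n)"
    using assms unfolding oracle_computable_def by metis
  then show ?thesis
    unfolding oracle_computable_def by (intro exI[of _ "RPair a b"]) simp
qed

text \<open>\<open>RRec\<close> carries one parameter, so \<open>n\<close> itself is passed as that
  parameter and \<open>A p n\<close> is substituted for the recursion argument at the end.
  \<open>G\<close> may depend on \<open>n\<close>, which permits nested recursions.\<close>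

lemma oc_rec:
  assumes "oracle_computable F"
    and "oracle_computable (\<lambda>p m. G p (pfst m) (pfst (psnd m)) (psnd (psnd m)))"
    and "oracle_computable A"
  shows "oracle_computable (\<lambda>p n. rec_nat (F p n) (G p n) (A p n))"
proof -
  obtain f g where f: "\<And>p n. eval f p n = Some (F p n)"
    and g: "\<And>p m. eval g p m = Some (G p (pfst m) (pfst (psnd m)) (psnd (psnd m)))"
    using assms unfolding oracle_computable_def by metis
  have "eval (RRec f g) p (prod_encode (n, k)) = Some (rec_nat (F p n) (G p n) k)" for p n k
    by (induction k) (simp_all add: f g)
  then have "oracle_computable (\<lambda>p m. rec_nat (F p (pfst m)) (G p (pfst m)) (psnd m))"
    unfolding oracle_computable_def by (metis prod_decode_inverse prod.collapse)
  from oc_comp[OF this oc_pair[OF oc_id assms(3)]] show ?thesis by simp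
qed

lemma oc_if_zero:
  assumes "oracle_computable A" "oracle_computable B" "oracle_computable C"
  shows "oracle_computable (\<lambda>p n. if A p n = 0 then B p n else C p n)"
proof -
  have "oracle_computable (\<lambda>p n. rec_nat (B p n) (\<lambda>_ _. C p n) (A p n))"
    by (rule oc_rec[OF assms(2) _ assms(1)]) (rule oc_comp[OF assms(3) oc_pfst_raw])
  moreover have "rec_nat b (\<lambda>_ _. c) a = (if a = 0 then b else c)" for a b c :: nat
    by (cases a) simp_all
  ultimately show ?thesis by simp
qed

lemma oc_add [oc_intros]:
  assumes "oracle_computable A" "oracle_computable B"
  shows "oracle_computable (\<lambda>p n. A p n + B p n)"
proof -
  have "oracle_computable (\<lambda>p n. rec_nat (A p n) (\<lambda>_. Suc) (B p n))"
    by (intro oc_rec assms oc_intros)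
  moreover have "rec_nat a (\<lambda>_. Suc) b = a + b" for a b :: nat
    by (induction b) simp_all
  ultimately show ?thesis by simp
qed

lemma oc_diff [oc_intros]:
  assumes "oracle_computable A" "oracle_computable B"
  shows "oracle_computable (\<lambda>p n. A p n - B p n)"
proof -
  \<comment> \<open>The recursion that returns its index instead of its previous value is the
    predecessor; iterating it gives truncated subtraction.\<close>
  have "oracle_computable (\<lambda>p n. rec_nat 0 (\<lambda>i _. i) n)"
    by (intro oc_rec oc_intros)
  moreover have "rec_nat 0 (\<lambda>i _. i) a = a - 1" for a :: nat
    by (cases a) simp_all
  ultimately have "oracle_computable (\<lambda>p n. n - 1)" by simp
  note pred = oc_comp[OF this]
  have "oracle_computable (\<lambda>p n. rec_nat (A p n) (\<lambda>_ r. r - 1) (B p n))"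
    by (intro oc_rec assms pred oc_intros)
  moreover have "rec_nat a (\<lambda>_ r. r - 1) b = a - b" for a b :: nat
    by (induction b) simp_all
  ultimately show ?thesis by simp
qed

lemma oc_if_eq [oc_intros]:
  assumes "oracle_computable A" "oracle_computable B" "oracle_computable C" "oracle_computable E"
  shows "oracle_computable (\<lambda>p n. if A p n = B p n then C p n else E p n)"
proof -
  have "oracle_computable
      (\<lambda>p n. if (A p n - B p n) + (B p n - A p n) = 0 then C p n else E p n)"
    by (intro oc_if_zero oc_intros assms)
  moreover have "(a - b) + (b - a) = 0 \<longleftrightarrow> a = b" for a b :: nat by auto
  ultimately show ?thesis by simp
qed

text \<open>The divisor is 4 because \<open>encode\<close> tells its four compound constructors
  apart by a residue modulo 4.\<close>

lemma oc_mod_4 [oc_intros]: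
  assumes "oracle_computable A"
  shows "oracle_computable (\<lambda>p n. A p n mod 4)"
proof -
  have "oracle_computable (\<lambda>p n. rec_nat 0 (\<lambda>_ r. if r = 3 then 0 else Suc r) (A p n))"
    by (intro oc_rec assms oc_intros)
  moreover have "rec_nat 0 (\<lambda>_ r. if r = 3 then 0 else Suc r) a = a mod 4" for a :: nat
    by (induction a) (simp_all add: mod_Suc)
  ultimately show ?thesis by simp
qed

lemma oc_div_4 [oc_intros]:
  assumes "oracle_computable A"
  shows "oracle_computable (\<lambda>p n. A p n div 4)"
proof -
  have "oracle_computable (\<lambda>p n. rec_nat 0 (\<lambda>i r. if Suc i mod 4 = 0 then Suc r else r) (A p n))"
    by (intro oc_rec assms oc_intros)
  moreover have "rec_nat 0 (\<lambda>i r. if Suc i mod 4 = 0 then Suc r else r) a = a div 4" for a :: nat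
    by (induction a) (simp_all add: div_Suc)
  ultimately show ?thesis by simp
qed

lemma oc_mult_4 [oc_intros]:
  assumes "oracle_computable A"
  shows "oracle_computable (\<lambda>p n. 4 * A p n)"
proof -
  have "oracle_computable (\<lambda>p n. (A p n + A p n) + (A p n + A p n))"
    by (intro assms oc_intros)
  moreover have "(a + a) + (a + a) = 4 * a" for a :: nat by simp
  ultimately show ?thesis by (simp only:)
qed

lemma oc_funpow [oc_intros]:
  assumes "oracle_computable S" "oracle_computable A" "oracle_computable K"
  shows "oracle_computable (\<lambda>p n. (S p ^^ K p n) (A p n))"
proof -
  have "oracle_computable (\<lambda>p n. rec_nat (A p n) (\<lambda>_. S p) (K p n))"
    by (intro oc_rec assms oc_comp[OF assms(1)] oc_intros)
  moreover have "rec_nat a (\<lambda>_. S p) k = (S p ^^ k) a" for p a k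
    by (induction k) simp_all
  ultimately show ?thesis by simp
qed


section \<open>A universal machine\<close>

text \<open>
  The machine state is \<open>(m, v, K)\<close>: with \<open>m = 0\<close> the value \<open>v\<close> is returned to the stack \<open>K\<close> of
  pending frames, and with \<open>m = Suc e\<close> the program with code \<open>e\<close> is about to be run on \<open>v\<close>.
  A frame is a tag with its data.
\<close>

definition Run :: "nat \<Rightarrow> nat \<Rightarrow> nat \<Rightarrow> nat" where
  "Run e v K = prod_encode (Suc e, prod_encode (v, K))"

definition Ret :: "nat \<Rightarrow> nat \<Rightarrow> nat" where
  "Ret v K = prod_encode (0, prod_encode (v, K))"

text \<open>The successor keeps 0 free as the code of the empty stack.\<close>

definition push :: "nat \<Rightarrow> nat \<Rightarrow> nat \<Rightarrow> nat" where
  "push t d K = Suc (prod_encode (prod_encode (t, d), K))"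

text \<open>After subtraction of 5, the residues 0 to 3 modulo 4 stand for \<open>RPair\<close>,
  \<open>RComp\<close>, \<open>RRec\<close>, \<open>RMu\<close>, and the quotient codes the
  subprograms.\<close>

definition run_step :: "cantor \<Rightarrow> nat \<Rightarrow> nat \<Rightarrow> nat \<Rightarrow> nat" where
  "run_step p e v K =
    (if e = 0 then Ret 0 K
     else if e = 1 then Ret (Suc v) K
     else if e = 2 then Ret (pfst v) K
     else if e = 3 then Ret (psnd v) K
     else if e = 4 then Ret (of_bool (p v)) K
     else if (e - 5) mod 4 = 0 then
       Run (pfst ((e - 5) div 4)) v (push 0 (prod_encode (psnd ((e - 5) div 4), v)) K)
     else if (e - 5) mod 4 = 1 then
       Run (psnd ((e - 5) div 4)) v (push 2 (pfst ((e - 5) div 4)) K)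
     else if (e - 5) mod 4 = 2 then
       Run (pfst ((e - 5) div 4)) (pfst v)
         (push 3 (prod_encode (prod_encode (psnd ((e - 5) div 4), pfst v),
                               prod_encode (0, psnd v))) K)
     else Run ((e - 5) div 4) (prod_encode (v, 0))
         (push 4 (prod_encode ((e - 5) div 4, prod_encode (v, 0))) K))"

text \<open>Tags: 0, the second half of a pair is still to be run; 1, the first value
  \<open>d\<close> of a pair is known; 2, an outer program waits; 3, a recursion with step program,
  parameter, index and rounds left; 4, a minimisation with program, input and current trial.\<close>

definition frame_step :: "nat \<Rightarrow> nat \<Rightarrow> nat \<Rightarrow> nat \<Rightarrow> nat" where
  "frame_step t d v K =
    (if t = 0 then Run (pfst d) (psnd d) (push 1 v K)
     else if t = 1 then Ret (prod_encode (d, v)) K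
     else if t = 2 then Run d v K
     else if t = 3 then
       (if psnd (psnd d) = 0 then Ret v K
        else Run (pfst (pfst d)) (prod_encode (psnd (pfst d), prod_encode (pfst (psnd d), v)))
               (push 3 (prod_encode (pfst d,
                  prod_encode (Suc (pfst (psnd d)), psnd (psnd d) - 1))) K))
     else
       (if v = 0 then Ret (psnd (psnd d)) K
        else Run (pfst d) (prod_encode (pfst (psnd d), Suc (psnd (psnd d))))
               (push 4 (prod_encode (pfst d,
                  prod_encode (pfst (psnd d), Suc (psnd (psnd d))))) K)))"

text \<open>A value returned to the empty stack is a fixed point, so a finished computation stays
  finished.\<close>

definition step :: "cantor \<Rightarrow> nat \<Rightarrow> nat" where
  "step p s =
    (if pfst s = 0 then
       (if psnd (psnd s) = 0 then s
        else frame_step (pfst (pfst (psnd (psnd s) - 1))) (psnd (pfst (psnd (psnd s) - 1)))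
               (pfst (psnd s)) (psnd (psnd (psnd s) - 1)))
     else run_step p (pfst s - 1) (pfst (psnd s)) (psnd (psnd s)))"

lemma oc_step: "oracle_computable step"
proof -
  have "oracle_computable (\<lambda>p s. step p s)"
    unfolding step_def run_step_def frame_step_def Run_def Ret_def push_def
    by (intro oc_intros)
  then show ?thesis .
qed

lemma step_Run: "step p (Run e v K) = run_step p e v K"
  by (simp add: step_def Run_def)

lemma step_Ret_push: "step p (Ret v (push t d K)) = frame_step t d v K"
  by (simp add: step_def Ret_def push_def)

lemma step_Ret_0: "step p (Ret v 0) = Ret v 0"
  by (simp add: step_def Ret_def)

lemma Run_neq_Ret [simp]: "Run e v K \<noteq> Ret w L"
  by (simp add: Run_def Ret_def)

lemma Ret_push_neq [simp]: "Ret v (push t d K) \<noteq> Ret w 0"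
  by (simp add: Ret_def push_def)

lemma add_4_mult_mod_div:
  fixes m :: nat
  shows "(3 + 4 * m) mod 4 = 3" "(3 + 4 * m) div 4 = m"
    "(2 + 4 * m) mod 4 = 2" "(2 + 4 * m) div 4 = m"
    "Suc (4 * m) mod 4 = 1" "Suc (4 * m) div 4 = m"
  by presburger+

lemma run_step_encode:
  "run_step p (encode RZero) v K = Ret 0 K"
  "run_step p (encode RSucc) v K = Ret (Suc v) K"
  "run_step p (encode RFst) v K = Ret (pfst v) K"
  "run_step p (encode RSnd) v K = Ret (psnd v) K"
  "run_step p (encode ROracle) v K = Ret (of_bool (p v)) K"
  "run_step p (encode (RPair f g)) v K =
    Run (encode f) v (push 0 (prod_encode (encode g, v)) K)"
  "run_step p (encode (RComp f g)) v K = Run (encode g) v (push 2 (encode f) K)"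
  "run_step p (encode (RRec f g)) v K = Run (encode f) (pfst v)
     (push 3 (prod_encode (prod_encode (encode g, pfst v), prod_encode (0, psnd v))) K)"
  "run_step p (encode (RMu f)) v K = Run (encode f) (prod_encode (v, 0))
     (push 4 (prod_encode (encode f, prod_encode (v, 0))) K)"
  by (simp_all add: run_step_def add_4_mult_mod_div[simplified])

section \<open>Soundness of the machine: halting runs compute values\<close>

definition halts_in :: "cantor \<Rightarrow> nat \<Rightarrow> nat \<Rightarrow> bool" where
  "halts_in p k s \<longleftrightarrow> (\<exists>w. (step p ^^ k) s = Ret w 0)"

lemma halts_in_0: "halts_in p 0 s \<longleftrightarrow> (\<exists>w. s = Ret w 0)"
  by (simp add: halts_in_def)

lemma halts_in_Suc: "halts_in p (Suc k) s \<longleftrightarrow> halts_in p k (step p s)"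
  by (simp add: halts_in_def funpow_swap1)

lemma halts_in_mono:
  assumes "halts_in p k s" "k \<le> l"
  shows "halts_in p l s"
  using assms(2,1) by (induction rule: dec_induct) (auto simp: halts_in_def step_Ret_0)

lemma halts_in_Run:
  assumes "halts_in p k (Run e v K)"
  obtains l where "l < k" "halts_in p l (run_step p e v K)"
  using assms by (cases k) (auto simp: halts_in_0 halts_in_Suc step_Run)

lemma halts_in_push:
  assumes "halts_in p k (Ret v (push t d K))"
  obtains l where "l < k" "halts_in p l (frame_step t d v K)"
  using assms by (cases k) (auto simp: halts_in_0 halts_in_Suc step_Ret_push)

text \<open>A run that empties the whole stack must first return a value to \<open>K\<close>, and
  then strictly fewer steps remain. The arbitrary \<open>K\<close> makes the induction on the
  program work under pending frames.\<close>

lemma halts_in_Run_imp_eval: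
  "halts_in p k (Run (encode c) n K) \<Longrightarrow>
   \<exists>v l. l < k \<and> eval c p n = Some v \<and> halts_in p l (Ret v K)"
proof (induction c arbitrary: n K k)
  case (RPair f g)
  from RPair.prems obtain l where "l < k"
    and "halts_in p l (Run (encode f) n (push 0 (prod_encode (encode g, n)) K))"
    by (auto elim!: halts_in_Run simp only: run_step_encode)
  with RPair.IH(1) obtain a l1 where a: "l1 < k" "eval f p n = Some a"
    "halts_in p l1 (Ret a (push 0 (prod_encode (encode g, n)) K))" by (meson order.strict_trans)
  from a(3) obtain l2 where "l2 < l1" "halts_in p l2 (Run (encode g) n (push 1 a K))"
    by (auto elim!: halts_in_push simp: frame_step_def)
  with RPair.IH(2) obtain b l3 where b: "l3 < l1" "eval g p n = Some b"
    "halts_in p l3 (Ret b (push 1 a K))" by (meson order.strict_trans)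
  from b(3) obtain l4 where "l4 < l3" "halts_in p l4 (Ret (prod_encode (a, b)) K)"
    by (auto elim!: halts_in_push simp: frame_step_def)
  then show ?case using a b by (intro exI[of _ "prod_encode (a, b)"] exI[of _ l4]) auto
next
  case (RComp f g)
  from RComp.prems obtain l where "l < k"
    and "halts_in p l (Run (encode g) n (push 2 (encode f) K))"
    by (auto elim!: halts_in_Run simp only: run_step_encode)
  with RComp.IH(2) obtain a l1 where a: "l1 < k" "eval g p n = Some a"
    "halts_in p l1 (Ret a (push 2 (encode f) K))" by (meson order.strict_trans)
  from a(3) obtain l2 where "l2 < l1" "halts_in p l2 (Run (encode f) a K)"
    by (auto elim!: halts_in_push simp: frame_step_def)
  with RComp.IH(1) obtain b l3 where "l3 < l1" "eval f p a = Some b" "halts_in p l3 (Ret b K)"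
    by (meson order.strict_trans)
  then show ?case using a by (intro exI[of _ b] exI[of _ l3]) auto
next
  case (RRec f g)
  define x where "x = pfst n"
  define R where "R k = rec_nat (eval f p x)
     (\<lambda>i r. Option.bind r (\<lambda>v. eval g p (prod_encode (x, prod_encode (i, v))))) k" for k
  let ?F = "\<lambda>i d. push 3 (prod_encode (prod_encode (encode g, x), prod_encode (i, d))) K"
  \<comment> \<open>Invariant: the value after \<open>i\<close> rounds is returned to a frame with
    \<open>d\<close> rounds left.\<close>
  have loop: "\<exists>w l. l < k \<and> R (i + d) = Some w \<and> halts_in p l (Ret w K)"
    if "R i = Some v" "halts_in p k (Ret v (?F i d))" for i d v k
    using that
  proof (induction d arbitrary: i v k)
    case 0
    from 0(2) obtain l where "l < k" "halts_in p l (Ret v K)"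
      by (auto elim!: halts_in_push simp: frame_step_def)
    with 0(1) show ?case by auto
  next
    case (Suc d)
    from Suc.prems(2) obtain l where "l < k" "halts_in p l
        (Run (encode g) (prod_encode (x, prod_encode (i, v))) (?F (Suc i) d))"
      by (auto elim!: halts_in_push simp: frame_step_def)
    with RRec.IH(2) obtain w l1 where w: "l1 < k"
      "eval g p (prod_encode (x, prod_encode (i, v))) = Some w"
      "halts_in p l1 (Ret w (?F (Suc i) d))" by (meson order.strict_trans)
    have "R (Suc i) = Some w" using Suc.prems(1) w(2) by (simp add: R_def)
    from Suc.IH[OF this w(3)] w(1) show ?case by (auto intro: order.strict_trans)
  qed
  from RRec.prems obtain l where "l < k" "halts_in p l (Run (encode f) x (?F 0 (psnd n)))"
    by (auto elim!: halts_in_Run simp only: run_step_encode x_def)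
  with RRec.IH(1) obtain v l1 where v: "l1 < k" "eval f p x = Some v"
    "halts_in p l1 (Ret v (?F 0 (psnd n)))" by (meson order.strict_trans)
  from v(2) have "R 0 = Some v" by (simp add: R_def)
  from loop[OF this v(3)] v(1) show ?case
    by (auto simp: R_def x_def intro: order.strict_trans)
next
  case (RMu f)
  let ?F = "\<lambda>m. push 4 (prod_encode (encode f, prod_encode (n, m))) K"
  let ?E = "\<lambda>m. eval f p (prod_encode (n, m))"
  \<comment> \<open>The search has no bound known in advance, so the induction is on the number of
    steps; all trials below \<open>m\<close> are already known to be defined and nonzero.\<close>
  have loop: "\<exists>w l. l < k \<and> eval (RMu f) p n = Some w \<and> halts_in p l (Ret w K)"
    if "\<forall>i<m. ?E i \<noteq> None \<and> ?E i \<noteq> Some 0"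
      and "halts_in p k (Run (encode f) (prod_encode (n, m)) (?F m))" for m k
    using that
  proof (induction k arbitrary: m rule: less_induct)
    case (less k)
    from RMu.IH[OF less.prems(2)] obtain v l where v: "l < k" "?E m = Some v"
      "halts_in p l (Ret v (?F m))" by blast
    show ?case
    proof (cases "v = 0")
      case True
      with v(3) obtain l1 where "l1 < l" "halts_in p l1 (Ret m K)"
        by (auto elim!: halts_in_push simp: frame_step_def)
      moreover have "(LEAST i. ?E i = Some 0) = m"
        using v(2) True less.prems(1) by (intro Least_equality) (auto simp: not_less[symmetric])
      then have "eval (RMu f) p n = Some m" using v(2) True less.prems(1) by auto
      ultimately show ?thesis using v(1) by (auto intro: order.strict_trans)
    next
      case False
      with v(3) obtain l1 where l1: "l1 < l"
        "halts_in p l1 (Run (encode f) (prod_encode (n, Suc m)) (?F (Suc m)))"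
        by (auto elim!: halts_in_push simp: frame_step_def)
      have "\<forall>i<Suc m. ?E i \<noteq> None \<and> ?E i \<noteq> Some 0"
        using less.prems(1) v(2) False by (auto simp: less_Suc_eq)
      from less.IH[OF _ this l1(2)] l1(1) v(1) show ?thesis
        by (meson order.strict_trans)
    qed
  qed
  from RMu.prems obtain l where "l < k"
    "halts_in p l (Run (encode f) (prod_encode (n, 0)) (?F 0))"
    by (auto elim!: halts_in_Run simp only: run_step_encode)
  with loop[of 0 l] show ?case by (auto intro: order.strict_trans simp del: eval.simps)
qed (erule halts_in_Run, unfold run_step_encode eval.simps, blast)+

section \<open>Completeness of the machine: defined values are reached\<close>

definition reaches :: "cantor \<Rightarrow> nat \<Rightarrow> nat \<Rightarrow> bool" where
  "reaches p s t \<longleftrightarrow> (\<exists>k. (step p ^^ k) s = t)"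

lemma reaches_refl: "reaches p s s"
  unfolding reaches_def by (rule exI[of _ 0]) simp

lemma reaches_trans [trans]: "reaches p s t \<Longrightarrow> reaches p t u \<Longrightarrow> reaches p s u"
  unfolding reaches_def by (metis comp_apply funpow_add)

lemma reaches_Run: "reaches p (run_step p e v K) t \<Longrightarrow> reaches p (Run e v K) t"
  unfolding reaches_def by (metis comp_apply funpow_Suc_right step_Run)

lemma reaches_push: "reaches p (frame_step t d v K) u \<Longrightarrow> reaches p (Ret v (push t d K)) u"
  unfolding reaches_def by (metis comp_apply funpow_Suc_right step_Ret_push)

lemma eval_imp_reaches:
  "eval c p n = Some v \<Longrightarrow> reaches p (Run (encode c) n K) (Ret v K)"
proof (induction c arbitrary: n K v)
  case (RPair f g)
  then obtain a b where ab: "eval f p n = Some a" "eval g p n = Some b" "v = prod_encode (a, b)"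
    by (auto simp: bind_eq_Some_conv)
  have "reaches p (Run (encode f) n (push 0 (prod_encode (encode g, n)) K))
      (Ret a (push 0 (prod_encode (encode g, n)) K))" by (rule RPair.IH(1)[OF ab(1)])
  also have "reaches p \<dots> (Ret b (push 1 a K))"
    by (rule reaches_push) (use RPair.IH(2)[OF ab(2)] in \<open>simp add: frame_step_def\<close>)
  also have "reaches p \<dots> (Ret v K)"
    by (rule reaches_push) (simp add: frame_step_def ab reaches_refl)
  finally show ?case by (intro reaches_Run) (simp only: run_step_encode)
next
  case (RComp f g)
  then obtain a where a: "eval g p n = Some a" "eval f p a = Some v"
    by (auto simp: bind_eq_Some_conv)
  have "reaches p (Run (encode g) n (push 2 (encode f) K)) (Ret a (push 2 (encode f) K))"
    by (rule RComp.IH(2)[OF a(1)])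
  also have "reaches p \<dots> (Ret v K)"
    by (rule reaches_push) (use RComp.IH(1)[OF a(2)] in \<open>simp add: frame_step_def\<close>)
  finally show ?case by (intro reaches_Run) (simp only: run_step_encode)
next
  case (RRec f g)
  define x where "x = pfst n"
  define R where "R k = rec_nat (eval f p x)
     (\<lambda>i r. Option.bind r (\<lambda>v. eval g p (prod_encode (x, prod_encode (i, v))))) k" for k
  let ?F = "\<lambda>i d. push 3 (prod_encode (prod_encode (encode g, x), prod_encode (i, d))) K"
  \<comment> \<open>The initial frame asks for \<open>i + d\<close> rounds, so that exactly
    \<open>d\<close> are left after \<open>i\<close>; in the end \<open>d = 0\<close>.\<close>
  have loop: "reaches p (Run (encode f) x (?F 0 (i + d))) (Ret w (?F i d))"
    if "R i = Some w" for i d w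
    using that
  proof (induction i arbitrary: d w)
    case 0
    then show ?case using RRec.IH(1) by (simp add: R_def)
  next
    case (Suc i)
    then obtain u where u: "R i = Some u" "eval g p (prod_encode (x, prod_encode (i, u))) = Some w"
      by (auto simp: R_def bind_eq_Some_conv)
    have "reaches p (Run (encode f) x (?F 0 (Suc i + d))) (Ret u (?F i (Suc d)))"
      using Suc.IH[OF u(1), of "Suc d"] by simp
    also have "reaches p \<dots> (Ret w (?F (Suc i) d))"
      by (rule reaches_push) (use RRec.IH(2)[OF u(2)] in \<open>simp add: frame_step_def\<close>)
    finally show ?case .
  qed
  have "R (psnd n) = Some v" using RRec.prems by (simp add: R_def x_def)
  from loop[OF this, of 0]
  have "reaches p (Run (encode f) x (?F 0 (psnd n))) (Ret v (?F (psnd n) 0))" by simp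
  also have "reaches p \<dots> (Ret v K)"
    by (rule reaches_push) (simp add: frame_step_def reaches_refl)
  finally show ?case by (intro reaches_Run) (simp only: run_step_encode x_def)
next
  case (RMu f)
  let ?F = "\<lambda>m. push 4 (prod_encode (encode f, prod_encode (n, m))) K"
  let ?E = "\<lambda>m. eval f p (prod_encode (n, m))"
  have ex: "\<exists>m. ?E m = Some 0 \<and> (\<forall>i<m. ?E i \<noteq> None)"
    and v: "v = (LEAST m. ?E m = Some 0)"
    using RMu.prems by (auto split: if_splits)
  have v0: "?E v = Some 0" unfolding v using ex by (auto intro: LeastI)
  \<comment> \<open>Below \<open>v\<close> a value is nonzero by minimality, and defined because
    \<open>v\<close> is at most the witness from \<open>ex\<close>, below which all values are
    defined.\<close>
  have below: "\<exists>w. ?E i = Some (Suc w)" if "i < v" for i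
  proof -
    have "?E i \<noteq> Some 0" using that unfolding v by (rule not_less_Least)
    moreover from ex obtain m where "?E m = Some 0" "\<forall>i<m. ?E i \<noteq> None" by blast
    then have "?E i \<noteq> None" using that Least_le[of "\<lambda>m. ?E m = Some 0" m] unfolding v by auto
    ultimately show ?thesis by (metis not0_implies_Suc option.exhaust)
  qed
  have loop: "m \<le> v \<Longrightarrow> reaches p (Run (encode f) (prod_encode (n, 0)) (?F 0))
      (Run (encode f) (prod_encode (n, m)) (?F m))" for m
  proof (induction m)
    case 0
    then show ?case by (simp add: reaches_refl)
  next
    case (Suc m)
    then obtain w where w: "?E m = Some (Suc w)" using below[of m] by auto
    have "reaches p (Run (encode f) (prod_encode (n, 0)) (?F 0))
      (Run (encode f) (prod_encode (n, m)) (?F m))" using Suc by simp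
    also have "reaches p \<dots> (Ret (Suc w) (?F m))" by (rule RMu.IH[OF w])
    also have "reaches p \<dots> (Run (encode f) (prod_encode (n, Suc m)) (?F (Suc m)))"
      by (rule reaches_push) (simp add: frame_step_def reaches_refl)
    finally show ?case .
  qed
  have "reaches p (Run (encode f) (prod_encode (n, 0)) (?F 0))
      (Run (encode f) (prod_encode (n, v)) (?F v))" by (rule loop) simp
  also have "reaches p \<dots> (Ret 0 (?F v))" by (rule RMu.IH[OF v0])
  also have "reaches p \<dots> (Ret v K)"
    by (rule reaches_push) (simp add: frame_step_def reaches_refl)
  finally show ?case by (intro reaches_Run) (simp only: run_step_encode)
qed (auto intro!: reaches_Run reaches_refl simp only: run_step_encode eval.simps option.inject)

section \<open>Membership in open sets through step-bounded halting\<close>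

lemma ce_open_iff_halts_in:
  "p \<in> ce_open c i \<longleftrightarrow> (\<exists>k. halts_in p k (Run (encode c) i 0))"
proof
  assume "p \<in> ce_open c i"
  then obtain v where "eval c p i = Some v" by (auto simp: ce_open_def)
  from eval_imp_reaches[OF this, of 0] show "\<exists>k. halts_in p k (Run (encode c) i 0)"
    by (auto simp: reaches_def halts_in_def)
next
  assume "\<exists>k. halts_in p k (Run (encode c) i 0)"
  then show "p \<in> ce_open c i"
    using halts_in_Run_imp_eval by (fastforce simp: ce_open_def)
qed

lemma oc_if_halts_in [oc_intros]:
  assumes "oracle_computable K" "oracle_computable E" "oracle_computable N"
    "oracle_computable A" "oracle_computable B"
  shows "oracle_computable
    (\<lambda>p n. if halts_in p (K p n) (Run (E p n) (N p n) 0) then A p n else B p n)"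
proof -
  \<comment> \<open>A final state is recognised by mode 0 and empty stack, whatever its value, so
    the test is a single equality of codes.\<close>
  have "halts_in p k s \<longleftrightarrow>
      prod_encode (pfst ((step p ^^ k) s), psnd (psnd ((step p ^^ k) s))) = prod_encode (0, 0)"
    for p k s
    unfolding halts_in_def Ret_def
    by (auto simp: prod_eq_iff)
       (metis prod.collapse prod_decode_inverse)
  then show ?thesis unfolding Run_def
    by (simp only:) (intro oc_intros assms oc_step)
qed


section \<open>From names to limits\<close>

text \<open>\<open>candidate h k\<close> is the current candidate after \<open>k\<close> rounds; \<open>h l j\<close> means that
  \<open>j\<close> is refuted by round \<open>l\<close>.\<close>

definition candidate :: "(nat \<Rightarrow> nat \<Rightarrow> bool) \<Rightarrow> nat \<Rightarrow> nat" where
  "candidate h k = rec_nat 0 (\<lambda>l j. if h l j then Suc j else j) k"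

text \<open>The pointer cannot pass the unrefuted \<open>m\<close>, so it is bounded and increasing
  and settles on its maximum.\<close>

lemma candidate_converges:
  assumes mono: "\<And>j k l. h k j \<Longrightarrow> k \<le> l \<Longrightarrow> h l j"
    and "\<And>k. \<not> h k m"
  shows "\<exists>j. (\<forall>k. \<not> h k j) \<and> eventually (\<lambda>k. candidate h k = j) sequentially"
proof -
  let ?J = "candidate h"
  have Suc: "?J (Suc k) = (if h k (?J k) then Suc (?J k) else ?J k)" for k
    by (simp add: candidate_def)
  have bound: "?J k \<le> m" for k
    by (induction k) (use assms(2) in \<open>auto simp: Suc le_less candidate_def[of _ 0]\<close>)
  have inc: "k \<le> l \<Longrightarrow> ?J k \<le> ?J l" for k l
    by (rule lift_Suc_mono_le[of ?J]) (simp_all add: Suc)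
  define j where "j = Max (range ?J)"
  have fin: "finite (range ?J)" by (rule finite_subset[of _ "{..m}"]) (use bound in auto)
  then have "j \<in> range ?J" unfolding j_def by (intro Max_in) auto
  then obtain k0 where k0: "?J k0 = j" by auto
  have le: "?J k \<le> j" for k unfolding j_def using fin by (intro Max_ge) auto
  have const: "?J k = j" if "k0 \<le> k" for k using inc[OF that] le[of k] k0 by simp
  have "\<not> h k j" for k
  proof
    assume "h k j"
    \<comment> \<open>In a round past both \<open>k\<close> and \<open>k0\<close> the pointer stands
      at \<open>j\<close> and the refutation persists, so it would move beyond the maximum.\<close>
    then have "h (max k k0) j" by (rule mono) simp
    then have "?J (Suc (max k k0)) = Suc j" by (simp add: Suc const)
    with le[of "Suc (max k k0)"] show False by simp
  qed
  with const show ?thesis unfolding eventually_sequentially by blast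
qed

section \<open>Oracle-free programs run under an arbitrary oracle\<close>

primrec without_oracle :: "prog \<Rightarrow> prog" where
  "without_oracle RZero = RZero"
| "without_oracle RSucc = RSucc"
| "without_oracle RFst = RFst"
| "without_oracle RSnd = RSnd"
| "without_oracle ROracle = RZero"
| "without_oracle (RPair f g) = RPair (without_oracle f) (without_oracle g)"
| "without_oracle (RComp f g) = RComp (without_oracle f) (without_oracle g)"
| "without_oracle (RRec f g) = RRec (without_oracle f) (without_oracle g)"
| "without_oracle (RMu f) = RMu (without_oracle f)"

lemma eval_without_oracle: "eval (without_oracle c) p n = eval c (\<lambda>_. False) n"
proof -
  \<comment> \<open>Equality of functions is the convenient induction hypothesis, as
    \<open>eval\<close> of \<open>RComp\<close> uses \<open>eval f p\<close> unapplied.\<close>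
  have "eval (without_oracle c) p = eval c (\<lambda>_. False)"
    by (induction c) (rule ext, simp)+
  then show ?thesis by simp
qed

lemma partial_computable_bind:
  assumes "partial_computable g" "partial_computable h"
  shows "partial_computable (\<lambda>n. Option.bind (g n) h)"
proof -
  obtain c d where "\<And>n. eval c (\<lambda>_. False) n = g n" "\<And>n. eval d (\<lambda>_. False) n = h n"
    using assms unfolding partial_computable_def by metis
  moreover from this(2) have "eval d (\<lambda>_. False) = h" by (simp add: fun_eq_iff)
  ultimately show ?thesis
    unfolding partial_computable_def by (intro exI[of _ "RComp d c"]) simp
qed

lemma oc_of_partial_computable:
  assumes "partial_computable (\<lambda>n. Some (g n))"
  shows "oracle_computable (\<lambda>p. g)"
proof -
  obtain c where "\<And>n. eval c (\<lambda>_. False) n = Some (g n)"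
    using assms unfolding partial_computable_def by metis
  then show ?thesis unfolding oracle_computable_def
    by (intro exI[of _ "without_oracle c"]) (simp add: eval_without_oracle)
qed

lemma partial_computable_of_oc:
  assumes "oracle_computable (\<lambda>p. g)"
  shows "partial_computable (\<lambda>n. Some (g n))"
  using assms unfolding oracle_computable_def partial_computable_def by metis

lemma tendsto_cantor_iff:
  fixes q :: "nat \<Rightarrow> cantor"
  shows "q \<longlonglongrightarrow> L \<longleftrightarrow> (\<forall>i. eventually (\<lambda>k. q k i = L i) sequentially)"
proof -
  have "q \<longlonglongrightarrow> L \<longleftrightarrow> (\<forall>i. (\<lambda>k. q k i) \<longlonglongrightarrow> L i)"
    using limitin_componentwise[of "\<lambda>_. euclidean" UNIV q L sequentially]
    by (simp add: euclidean_product_topology flip: limitin_canonical_iff)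
  then show ?thesis by (simp add: tendsto_discrete)
qed

text \<open>The candidate \<open>(t, i)\<close> claims that \<open>a\<close> (for \<open>t = 0\<close>) or \<open>b\<close> (otherwise) diverges on \<open>i\<close>;
  \<open>G\<close> is the coded pair of \<open>a\<close> and \<open>b\<close>.\<close>

definition refuted :: "nat \<Rightarrow> cantor \<Rightarrow> nat \<Rightarrow> nat \<Rightarrow> bool" where
  "refuted G p k j \<longleftrightarrow>
     halts_in p k (Run (if pfst j = 0 then pfst G else psnd G) (psnd j) 0)"

text \<open>For \<open>p \<in> S\<close> some run of \<open>a\<close> diverges and all runs of
  \<open>b\<close> halt; for \<open>p \<notin> S\<close> it is the other way round. So an unrefuted
  candidate exists, and each one has the correct type.\<close>

lemma delta2_name_limit:
  assumes "delta2_name X a b S" "p \<in> X"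
  shows "eventually (\<lambda>k.
    (pfst (candidate (refuted (prod_encode (encode a, encode b)) p) k) = 0) = (p \<in> S)) sequentially"
proof -
  let ?r = "refuted (prod_encode (encode a, encode b)) p"
  have S: "p \<in> S \<longleftrightarrow> (\<exists>i. p \<notin> ce_open a i)" "p \<in> S \<longleftrightarrow> (\<forall>i. p \<in> ce_open b i)"
    using assms unfolding delta2_name_def by auto
  have r: "(\<forall>k. \<not> ?r k j) \<longleftrightarrow> p \<notin> ce_open (if pfst j = 0 then a else b) (psnd j)" for j
    by (auto simp: refuted_def ce_open_iff_halts_in)
  obtain i where "p \<notin> ce_open (if (if p \<in> S then 0 else 1) = (0 :: nat) then a else b) i"
    using S by (cases "p \<in> S") auto
  then obtain t where "p \<notin> ce_open (if t = (0 :: nat) then a else b) i" ..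
  then have "\<not> ?r k (prod_encode (t, i))" for k using r[of "prod_encode (t, i)"] by simp
  from candidate_converges[of ?r, OF _ this]
  obtain j where j: "\<forall>k. \<not> ?r k j" "eventually (\<lambda>k. candidate ?r k = j) sequentially"
    using halts_in_mono unfolding refuted_def by blast
  from j(1) have "pfst j = 0 \<longleftrightarrow> p \<in> S" unfolding r using S by (auto split: if_splits)
  with j(2) show ?thesis by (auto elim: eventually_mono)
qed

lemma low_computable_if_measurable:
  assumes "effective_delta2_enumeration (dom f) D" "markov_delta2_measurable U D f"
  shows "low_computable U f"
proof -
  let ?S = "\<lambda>n. {p. \<exists>q. f p = Some q \<and> q \<in> U n}"
  obtain P where P: "partial_computable P" "\<And>n. \<exists>m. P n = Some m \<and> D m = Some (?S n)"
    using assms(2) unfolding markov_delta2_measurable_def by blast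
  obtain r where r: "partial_computable r"
    "\<And>n S. D n = Some S \<Longrightarrow>
      \<exists>a b. r n = Some (prod_encode (encode a, encode b)) \<and> delta2_name (dom f) a b S"
    using assms(1) unfolding effective_delta2_enumeration_def by blast
  have "\<forall>n. \<exists>c. Option.bind (P n) r = Some (prod_encode (encode (fst c), encode (snd c))) \<and>
      delta2_name (dom f) (fst c) (snd c) (?S n)"
  proof
    fix n
    show "\<exists>c. Option.bind (P n) r = Some (prod_encode (encode (fst c), encode (snd c))) \<and>
        delta2_name (dom f) (fst c) (snd c) (?S n)"
      using P(2)[of n] r(2) by force
  qed
  from choice[OF this] obtain c where c:
    "\<And>n. Option.bind (P n) r = Some (prod_encode (encode (fst (c n)), encode (snd (c n))))"
    "\<And>n. delta2_name (dom f) (fst (c n)) (snd (c n)) (?S n)" by blast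
  define a b where "a n = fst (c n)" and "b n = snd (c n)" for n
  note ab = c[folded a_def b_def]
  define G where "G n = prod_encode (encode (a n), encode (b n))" for n
  \<comment> \<open>\<open>P\<close> followed by \<open>r\<close> is total: each \<open>P n\<close>
    yields an index at which \<open>D\<close> is defined, and there \<open>r\<close> gives a
    name.\<close>
  have G: "oracle_computable (\<lambda>p. G)"
    using partial_computable_bind[OF P(1) r(1)] unfolding ab(1) G_def[symmetric]
    by (rule oc_of_partial_computable)
  define q where "q p k n \<longleftrightarrow> pfst (candidate (refuted (G n) p) k) = 0" for p k n
  \<comment> \<open>The bit \<open>q p k n\<close> is written out as a recursion over bounded
    halting tests; \<open>m\<close> codes \<open>(k, n)\<close>.\<close>
  have "oracle_computable (\<lambda>p m.
      if pfst (rec_nat 0 (\<lambda>l j. if halts_in p l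
           (Run (if pfst j = 0 then pfst (G (psnd m)) else psnd (G (psnd m))) (psnd j) 0)
         then Suc j else j) (pfst m)) = 0 then 1 else 0)"
    by (intro oc_rec oc_intros oc_comp[OF G])
  then obtain c where c: "\<And>p m. eval c p m = Some (of_bool (q p (pfst m) (psnd m)))"
    unfolding oracle_computable_def q_def candidate_def refuted_def of_bool_def by blast
  show ?thesis
    unfolding low_computable_def
  proof (intro exI[of _ c] allI impI)
    fix p y assume y: "f p = Some y"
    have "q p \<longlonglongrightarrow> turing_jump U y"
      unfolding tendsto_cantor_iff
    proof
      fix n
      have "p \<in> dom f" using y by blast
      from delta2_name_limit[OF ab(2) this, of n]
      show "eventually (\<lambda>k. q p k n = turing_jump U y n) sequentially"
        using y by (simp add: q_def G_def turing_jump_def)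
    qed
    then show "\<exists>q. (\<forall>k i. eval c p (prod_encode (k, i)) = Some (of_bool (q k i))) \<and>
        q \<longlonglongrightarrow> turing_jump U y"
      by (intro exI[of _ "q p"]) (simp add: c)
  qed
qed


section \<open>From limits to names\<close>

text \<open>The s-m-n construction: \<open>n\<close> is hard-wired as a numeral, and
  \<open>RPair RFst RSnd\<close> passes the input on unchanged.\<close>

definition fix_first :: "prog \<Rightarrow> nat \<Rightarrow> prog" where
  "fix_first c n = RComp c (RPair (((RComp RSucc) ^^ n) RZero) (RPair RFst RSnd))"

lemma eval_fix_first: "eval (fix_first c n) p i = eval c p (prod_encode (n, i))"
proof -
  have "eval (((RComp RSucc) ^^ n) RZero) p i = Some n" by (induction n) simp_all
  then show ?thesis by (simp add: fix_first_def)
qed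

lemma oc_encode_fix_first: "oracle_computable (\<lambda>p n. encode (fix_first c n))"
proof -
  \<comment> \<open>\<open>RSucc\<close> has code 1, so each further \<open>RComp RSucc\<close> acts
    on codes by one fixed computable map, iterated from the code 0 of \<open>RZero\<close>.\<close>
  have "encode (((RComp RSucc) ^^ n) RZero) =
      ((\<lambda>m. 6 + 4 * prod_encode (1, m)) ^^ n) 0" for n
    by (induction n) simp_all
  then show ?thesis
    unfolding fix_first_def encode.simps by (simp only:) (intro oc_intros)
qed

lemma eval_RMu_total:
  assumes "\<And>m. eval f p (prod_encode (n, m)) = Some (g m)"
  shows "eval (RMu f) p n \<noteq> None \<longleftrightarrow> (\<exists>m. g m = 0)"
  using assms by simp

text \<open>\<open>h\<close> selects the kind of value sought. Totality of \<open>c\<close> is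
  assumed only for the oracle and column at hand, since low computability constrains
  \<open>c\<close> only on the domain of \<open>f\<close>.\<close>

lemma eval_search:
  assumes "oracle_computable (\<lambda>p. h)"
  obtains d where "\<And>p n i g. (\<And>k. eval c p (prod_encode (k, n)) = Some (g k)) \<Longrightarrow>
    eval d p (prod_encode (n, i)) \<noteq> None \<longleftrightarrow> (\<exists>k\<ge>i. h (g k) = 0)"
proof -
  obtain e where e: "\<And>p m. eval e p m = Some (h m)"
    using assms unfolding oracle_computable_def by blast
  \<comment> \<open>The minimisation sees \<open>((n, i), m)\<close>; this is rearranged into
    \<open>(i + m, n)\<close>, so the search starts at \<open>i\<close>.\<close>
  have "oracle_computable (\<lambda>p m. prod_encode (psnd (pfst m) + psnd m, pfst (pfst m)))"
    by (intro oc_intros)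
  then obtain t where t:
    "\<And>p m. eval t p m = Some (prod_encode (psnd (pfst m) + psnd m, pfst (pfst m)))"
    unfolding oracle_computable_def by blast
  show ?thesis
  proof (rule that[of "RMu (RComp e (RComp c t))"])
    fix p n i g assume g: "\<And>k. eval c p (prod_encode (k, n)) = Some (g k)"
    have "eval (RMu (RComp e (RComp c t))) p (prod_encode (n, i)) \<noteq> None \<longleftrightarrow>
        (\<exists>m. h (g (i + m)) = 0)"
      by (rule eval_RMu_total) (simp add: e t g)
    then show "eval (RMu (RComp e (RComp c t))) p (prod_encode (n, i)) \<noteq> None \<longleftrightarrow>
        (\<exists>k\<ge>i. h (g k) = 0)"
      by (metis le_add1 le_Suc_ex)
  qed
qed

lemma measurable_if_low_computable:
  assumes "effective_delta2_enumeration (dom f) D" "low_computable U f"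
  shows "markov_delta2_measurable U D f"
proof -
  let ?S = "\<lambda>n. {p. \<exists>q. f p = Some q \<and> q \<in> U n}"
  obtain c where c: "\<And>p y. f p = Some y \<Longrightarrow> \<exists>q :: nat \<Rightarrow> cantor.
      (\<forall>k i. eval c p (prod_encode (k, i)) = Some (of_bool (q k i))) \<and> q \<longlonglongrightarrow> turing_jump U y"
    using assms(2) unfolding low_computable_def by blast
  obtain s where s: "partial_computable s"
    "\<And>a b S. delta2_name (dom f) a b S \<Longrightarrow>
      \<exists>n. s (prod_encode (encode a, encode b)) = Some n \<and> D n = Some S"
    using assms(1) unfolding effective_delta2_enumeration_def by blast
  \<comment> \<open>With the identity, \<open>a\<close> searches for a bit 0 from position
    \<open>i\<close> on; with \<open>1 - m\<close> below, \<open>b\<close> searches for a bit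
    1.\<close>
  have "oracle_computable (\<lambda>p m. m)" by (rule oc_id)
  from eval_search[OF this, of c] obtain a where
    a: "\<And>p n i g. (\<And>k. eval c p (prod_encode (k, n)) = Some (g k)) \<Longrightarrow>
        eval a p (prod_encode (n, i)) \<noteq> None \<longleftrightarrow> (\<exists>k\<ge>i. g k = 0)" by blast
  have "oracle_computable (\<lambda>p m. 1 - m)" by (intro oc_intros)
  from eval_search[OF this, of c] obtain b where
    b: "\<And>p n i g. (\<And>k. eval c p (prod_encode (k, n)) = Some (g k)) \<Longrightarrow>
        eval b p (prod_encode (n, i)) \<noteq> None \<longleftrightarrow> (\<exists>k\<ge>i. 1 - g k = 0)"
    by blast
  have name: "delta2_name (dom f) (fix_first a n) (fix_first b n) (?S n)" for n
  proof -
    have "(y \<in> U n) = (\<exists>i. p \<notin> ce_open (fix_first a n) i) \<and>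
          (y \<in> U n) = (\<forall>i. p \<in> ce_open (fix_first b n) i)" if y: "f p = Some y" for p y
    proof -
      obtain q :: "nat \<Rightarrow> cantor" where
        q: "\<And>k i. eval c p (prod_encode (k, i)) = Some (of_bool (q k i))"
        and lim: "q \<longlonglongrightarrow> turing_jump U y" using c[OF y] by blast
      have "p \<in> ce_open (fix_first a n) i \<longleftrightarrow> (\<exists>k\<ge>i. \<not> q k n)" for i
        using a[of p n "\<lambda>k. of_bool (q k n)" i, OF q] by (simp add: ce_open_def eval_fix_first)
      moreover have "p \<in> ce_open (fix_first b n) i \<longleftrightarrow> (\<exists>k\<ge>i. q k n)" for i
        using b[of p n "\<lambda>k. of_bool (q k n)" i, OF q]
        by (auto simp: ce_open_def eval_fix_first of_bool_def split: if_splits)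
      moreover obtain K where "\<And>k. k \<ge> K \<Longrightarrow> q k n = (y \<in> U n)"
        using lim unfolding tendsto_cantor_iff eventually_sequentially turing_jump_def by blast
      \<comment> \<open>From \<open>K\<close> on the bit is constant, so holding almost always and
        holding infinitely often both agree with the limit; \<open>max i K\<close> reconciles the
        bounds.\<close>
      then have "(y \<in> U n) = (\<exists>i. \<forall>k\<ge>i. q k n)" "(y \<in> U n) = (\<forall>i. \<exists>k\<ge>i. q k n)"
        by (meson max.cobounded1 max.cobounded2)+
      ultimately show ?thesis by simp
    qed
    then show ?thesis unfolding delta2_name_def by (auto; blast)
  qed
  \<comment> \<open>Every \<open>g n\<close> codes a name, and on such codes \<open>s\<close> is
    guaranteed to be defined.\<close>
  define g where "g n = prod_encode (encode (fix_first a n), encode (fix_first b n))" for n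
  have "oracle_computable (\<lambda>p. g)"
    unfolding g_def by (intro oc_intros oc_encode_fix_first)
  from partial_computable_bind[OF partial_computable_of_oc[OF this] s(1)]
  have "partial_computable (\<lambda>n. s (g n))" by simp
  then show ?thesis
    unfolding markov_delta2_measurable_def using s(2)[OF name] unfolding g_def by blast
qed

theorem theorem13:
  fixes U :: "nat \<Rightarrow> cantor set"
    and f :: "cantor \<Rightarrow> cantor option"
    and D :: "nat \<Rightarrow> cantor set option"
  assumes "effective_open_enumeration U"
    and "effective_delta2_enumeration (dom f) D"
  shows "markov_delta2_measurable U D f \<longleftrightarrow> low_computable U f"
  using low_computable_if_measurable[OF assms(2)] measurable_if_low_computable[OF assms(2)]
  by blast

end
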